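(* Let $X$ be a zero-dimensional space and let $f$ be a continuous injection of $X$ into $\mathbb R$. Then $X$ can be continuously injected into the Cantor set, that is, there exists a continuous one-to-one map from $X$ into the Cantor set.
   Context: All spaces are assumed Tychonoff. A space is called zero-dimensional if its small inductive dimension $\mathrm{ind}$ equals $0$ (i.e. it is non-empty and has a base consisting of clopen sets). A continuous injection is a continuous one-to-one map (not necessarily a homeomorphic embedding). $\mathbb R$ carries the Euclidean topology. *)

theory Defs
  imports "HOL-Analysis.Analysis"
begin

definition tychonoff_space :: "'a topology \<Rightarrow> bool" where
  "tychonoff_space X \<longleftrightarrow> completely_regular_space X \<and> t1_space X"

text \<open>\<open>X dim_le n\<close> says that the small inductive dimension of \<open>X\<close> is at most \<open>n\<close>, with
  value \<open>-1\<close> exactly for the empty space. So the following says that it equals \<open>0\<close>.\<close>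

definition zero_dimensional_space :: "'a topology \<Rightarrow> bool" where
  "zero_dimensional_space X \<longleftrightarrow> X dim_le 0 \<and> \<not> X dim_le (-1)"

lemma zero_dimensional_space_iff_clopen_base:
  "zero_dimensional_space X \<longleftrightarrow>
     topspace X \<noteq> {} \<and> openin X = arbitrary union_of (\<lambda>U. closedin X U \<and> openin X U)"
  by (auto simp: zero_dimensional_space_def dimension_le_0_neighbourhood_base_of_clopen
      openin_topology_neighbourhood_base_unique)

text \<open>The middle-thirds set: passing from one stage to the next deletes the open middle third
  of every interval, which amounts to taking two copies scaled by \<open>1/3\<close>.\<close>

primrec cantor_stage :: "nat \<Rightarrow> real set" where
  "cantor_stage 0 = {0..1}"
| "cantor_stage (Suc n) =
     (\<lambda>x. x / 3) ` cantor_stage n \<union> (\<lambda>x. (x + 2) / 3) ` cantor_stage n"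

definition cantor_set :: "real set" where
  "cantor_set = (\<Inter>n. cantor_stage n)"

end

theory Submission
  imports Defs
begin

text \<open>
  Countably many clopen sets that separate the points of a space give a continuous injection
  into the Cantor set: record, as the digits \<open>0\<close> and \<open>2\<close> of a ternary expansion, to which of
  them a point belongs (\<open>continuous_injection_into_cantor_set\<close>). So it is enough to find, for
  all \<open>p < q\<close>, a clopen set containing \<open>{f \<le> p}\<close> and contained in \<open>{f < q}\<close>; those with
  rational \<open>p\<close> and \<open>q\<close> then separate points, because \<open>f\<close> is injective.

  A space with a clopen base need not admit such separations for an arbitrary real function.
  They exist here because the fibres of \<open>f\<close> have at most one point
  (\<open>clopen_between_sublevel_sets\<close>): choose \<open>c\<close> with \<open>p < c < q\<close>. The open set \<open>{f < c}\<close> can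
  only fail to be closed at the single point \<open>x\<close> with \<open>f x = c\<close>, if there is one, and this is
  repaired by adding a clopen neighbourhood of \<open>x\<close> that lies in \<open>{f < q}\<close>.
\<close>

lemma clopen_between_sublevel_sets:
  fixes f :: "'a \<Rightarrow> real"
  assumes X: "X dim_le 0" and f: "continuous_map X euclideanreal f"
    and inj: "inj_on f (topspace X)" and "p < q"
  obtains A where "closedin X A" "openin X A"
    "\<And>x. \<lbrakk>x \<in> topspace X; f x \<le> p\<rbrakk> \<Longrightarrow> x \<in> A" "\<And>x. x \<in> A \<Longrightarrow> f x < q"
proof -
  obtain c where c: "p < c" "c < q"
    using dense \<open>p < q\<close> by blast
  have open_less: "openin X {x \<in> topspace X. f x < r}" for r
    using openin_continuous_map_preimage[OF f, of "{..<r}"] by simp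
  have closed_le: "closedin X {x \<in> topspace X. f x \<le> c}"
    using closedin_continuous_map_preimage[OF f, of "{..c}"] by simp
  obtain U where U: "closedin X U" "openin X U" "\<And>x. x \<in> U \<Longrightarrow> f x < q"
    and fibre: "\<And>x. \<lbrakk>x \<in> topspace X; f x = c\<rbrakk> \<Longrightarrow> x \<in> U"
  proof (cases "\<exists>x \<in> topspace X. f x = c")
    case True
    then obtain x where x: "x \<in> topspace X" "f x = c" by blast
    have "openin X {x \<in> topspace X. f x < q} \<and> x \<in> {x \<in> topspace X. f x < q}"
      using open_less x c by simp
    then obtain U where U: "closedin X U" "openin X U" "x \<in> U" "U \<subseteq> {x \<in> topspace X. f x < q}"
      using X unfolding dimension_le_0_neighbourhood_base_of_clopen neighbourhood_base_of
      by (meson subset_iff)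
    have "y = x" if "y \<in> topspace X" "f y = c" for y
      using inj that x by (auto simp: inj_on_def)
    then show thesis using that[of U] U by blast
  next
    case False
    then show thesis using that[of "{}"] by simp
  qed
  have "{x \<in> topspace X. f x < c} \<union> U = {x \<in> topspace X. f x \<le> c} \<union> U"
    using fibre by force
  then have "closedin X ({x \<in> topspace X. f x < c} \<union> U)"
    using closed_le U(1) by (simp add: closedin_Un)
  moreover have "openin X ({x \<in> topspace X. f x < c} \<union> U)"
    using open_less U(2) by blast
  ultimately show thesis
    using that[of "{x \<in> topspace X. f x < c} \<union> U"] U(3) c by force
qed

text \<open>The real number whose \<open>n\<close>-th ternary digit after the point is \<open>2\<close> if \<open>b n\<close> holds and
  \<open>0\<close> otherwise, counting digits from \<open>n = 0\<close>.\<close>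

definition cantor_expansion :: "(nat \<Rightarrow> bool) \<Rightarrow> real" where
  "cantor_expansion b = (\<Sum>n. 2 * of_bool (b n) / 3 ^ Suc n)"

lemma sums_two_thirds: "(\<lambda>n. 2 / 3 ^ Suc n :: real) sums 1"
  using sums_mult[OF geometric_sums[of "1/3::real"], of "2/3"]
  by (simp add: power_divide)

lemma summable_cantor_expansion: "summable (\<lambda>n. 2 * of_bool (b n) / 3 ^ Suc n :: real)"
  by (rule summable_comparison_test'[OF sums_summable[OF sums_two_thirds], of 0]) simp

lemma cantor_expansion_nonneg: "0 \<le> cantor_expansion b"
  unfolding cantor_expansion_def
  by (rule suminf_nonneg[OF summable_cantor_expansion]) simp

lemma cantor_expansion_le_1: "cantor_expansion b \<le> 1"
proof -
  have "cantor_expansion b \<le> (\<Sum>n. 2 / 3 ^ Suc n)"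
    unfolding cantor_expansion_def
    by (rule suminf_le[OF _ summable_cantor_expansion sums_summable[OF sums_two_thirds]]) simp
  then show ?thesis using sums_unique[OF sums_two_thirds] by simp
qed

lemma cantor_expansion_shift:
  "cantor_expansion b = (cantor_expansion (\<lambda>n. b (Suc n)) + 2 * of_bool (b 0)) / 3"
proof -
  have "(\<Sum>n. 2 * of_bool (b (Suc n)) / 3 ^ Suc (Suc n)) = cantor_expansion (\<lambda>n. b (Suc n)) / 3"
    unfolding cantor_expansion_def
    by (subst suminf_divide[OF summable_cantor_expansion, symmetric]) (simp add: mult.commute)
  then show ?thesis
    using suminf_split_head[OF summable_cantor_expansion, of b]
    by (simp add: cantor_expansion_def add_divide_distrib)
qed

lemma cantor_expansion_in_stage: "cantor_expansion b \<in> cantor_stage n"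
proof (induction n arbitrary: b)
  case 0
  show ?case using cantor_expansion_nonneg cantor_expansion_le_1 by simp
next
  case (Suc n)
  show ?case
    using Suc.IH[of "\<lambda>k. b (Suc k)"] cantor_expansion_shift[of b]
    by (cases "b 0") (auto simp: image_iff)
qed

lemma cantor_expansion_in_cantor_set: "cantor_expansion b \<in> cantor_set"
  by (simp add: cantor_set_def cantor_expansion_in_stage)

lemma cantor_expansion_inject:
  "cantor_expansion b = cantor_expansion b' \<longleftrightarrow> b = b'"
proof
  assume "cantor_expansion b = cantor_expansion b'"
  then have "b n = b' n" for n
  proof (induction n arbitrary: b b')
    case (0 b b')
    \<comment> \<open>The value lies in \<open>{0..1/3}\<close> or in \<open>{2/3..1}\<close> according to the first digit.\<close>
    then show ?case
      using cantor_expansion_shift[of b] cantor_expansion_shift[of b']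
        cantor_expansion_nonneg[of "\<lambda>n. b (Suc n)"] cantor_expansion_le_1[of "\<lambda>n. b (Suc n)"]
        cantor_expansion_nonneg[of "\<lambda>n. b' (Suc n)"] cantor_expansion_le_1[of "\<lambda>n. b' (Suc n)"]
      by (cases "b 0"; cases "b' 0") auto
  next
    case (Suc n b b')
    have "b 0 = b' 0"
      using Suc.prems cantor_expansion_shift[of b] cantor_expansion_shift[of b']
        cantor_expansion_nonneg[of "\<lambda>n. b (Suc n)"] cantor_expansion_le_1[of "\<lambda>n. b (Suc n)"]
        cantor_expansion_nonneg[of "\<lambda>n. b' (Suc n)"] cantor_expansion_le_1[of "\<lambda>n. b' (Suc n)"]
      by (cases "b 0"; cases "b' 0") auto
    then have "cantor_expansion (\<lambda>n. b (Suc n)) = cantor_expansion (\<lambda>n. b' (Suc n))"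
      using Suc.prems cantor_expansion_shift[of b] cantor_expansion_shift[of b'] by simp
    then show ?case by (rule Suc.IH)
  qed
  then show "b = b'" by blast
qed simp

lemma cantor_expansion_close:
  assumes "\<And>k. k < n \<Longrightarrow> b k = b' k"
  shows "\<bar>cantor_expansion b - cantor_expansion b'\<bar> \<le> (1/3) ^ n"
  using assms
proof (induction n arbitrary: b b')
  case 0
  show ?case
    using cantor_expansion_nonneg[of b] cantor_expansion_le_1[of b]
      cantor_expansion_nonneg[of b'] cantor_expansion_le_1[of b'] by simp
next
  case (Suc n)
  let ?d = "cantor_expansion (\<lambda>k. b (Suc k)) - cantor_expansion (\<lambda>k. b' (Suc k))"
  have "cantor_expansion b - cantor_expansion b' = ?d / 3"
    using Suc.prems[of 0] cantor_expansion_shift[of b] cantor_expansion_shift[of b']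
    by (simp add: diff_divide_distrib)
  moreover have "\<bar>?d\<bar> \<le> (1/3) ^ n"
    by (rule Suc.IH) (simp add: Suc.prems)
  ultimately show ?case
    by (simp only: abs_divide) simp
qed

lemma continuous_map_cantor_expansion:
  assumes clopen: "\<And>n. closedin X (A n)" "\<And>n. openin X (A n)"
  shows "continuous_map X euclideanreal (\<lambda>x. cantor_expansion (\<lambda>n. x \<in> A n))"
proof -
  let ?g = "\<lambda>x. cantor_expansion (\<lambda>n. x \<in> A n)"
  have "\<exists>U. openin X U \<and> x \<in> U \<and> (\<forall>y\<in>U. ?g y \<in> ball (?g x) e)"
    if x: "x \<in> topspace X" and e: "e > 0" for x e
  proof -
    obtain n where n: "(1/3::real) ^ n < e"
      using real_arch_pow_inv[OF e, of "1/3"] by auto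
    have op: "openin X (if x \<in> A k then A k else topspace X - A k)" for k
      using clopen[of k] by auto
    \<comment> \<open>The points with the same first \<open>n\<close> digits as \<open>x\<close>.\<close>
    define U where
      "U = topspace X \<inter> (\<Inter>k\<in>{..<n}. if x \<in> A k then A k else topspace X - A k)"
    have "openin X U"
      unfolding U_def by (intro openin_Int_Inter) (use op in blast)+
    moreover have "x \<in> U"
      using x by (auto simp: U_def)
    moreover have "?g y \<in> ball (?g x) e" if "y \<in> U" for y
    proof -
      have "x \<in> A k \<longleftrightarrow> y \<in> A k" if "k < n" for k
        using \<open>y \<in> U\<close> that by (auto simp: U_def split: if_splits)
      then show ?thesis
        using cantor_expansion_close[of n "\<lambda>k. x \<in> A k" "\<lambda>k. y \<in> A k"] n
        by (simp add: dist_real_def)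
    qed
    ultimately show ?thesis by blast
  qed
  then show ?thesis
    using Met_TC.continuous_map_to_metric[of X ?g] by simp
qed

lemma continuous_injection_into_cantor_set:
  assumes "\<And>n::nat. closedin X (A n)" "\<And>n. openin X (A n)"
    and separating: "\<And>x y. \<lbrakk>x \<in> topspace X; y \<in> topspace X; x \<noteq> y\<rbrakk>
      \<Longrightarrow> \<exists>n. (x \<in> A n) \<noteq> (y \<in> A n)"
  shows "\<exists>g. continuous_map X (top_of_set cantor_set) g \<and> inj_on g (topspace X)"
proof (intro exI conjI)
  let ?g = "\<lambda>x. cantor_expansion (\<lambda>n. x \<in> A n)"
  show "continuous_map X (top_of_set cantor_set) ?g"
    using continuous_map_cantor_expansion assms(1,2)
    by (auto simp: continuous_map_in_subtopology cantor_expansion_in_cantor_set)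
  show "inj_on ?g (topspace X)"
    using separating by (auto simp: inj_on_def cantor_expansion_inject fun_eq_iff)
qed

theorem theorem2p2:
  fixes X :: "'a topology" and f :: "'a \<Rightarrow> real"
  assumes "tychonoff_space X"
    and "zero_dimensional_space X"
    and "continuous_map X euclideanreal f"
    and "inj_on f (topspace X)"
  shows "\<exists>g :: 'a \<Rightarrow> real.
           continuous_map X (top_of_set cantor_set) g \<and> inj_on g (topspace X)"
proof -
  have X: "X dim_le 0"
    using assms(2) by (simp add: zero_dimensional_space_def)
  have "\<exists>A. closedin X A \<and> openin X A \<and> (p < q \<longrightarrow>
      (\<forall>x\<in>topspace X. f x \<le> of_rat p \<longrightarrow> x \<in> A) \<and> (\<forall>x\<in>A. f x < of_rat q))" for p q :: rat
  proof (cases "p < q")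
    case True
    then have "(of_rat p :: real) < of_rat q" by (simp add: of_rat_less)
    from clopen_between_sublevel_sets[OF X assms(3,4) this] show ?thesis by metis
  next
    case False
    then show ?thesis using openin_empty closedin_empty by blast
  qed
  then obtain A where A: "\<And>p q. closedin X (A p q)" "\<And>p q. openin X (A p q)"
    and below: "\<And>p q x. \<lbrakk>p < q; x \<in> topspace X; f x \<le> of_rat p\<rbrakk> \<Longrightarrow> x \<in> A p q"
    and above: "\<And>p q x. \<lbrakk>p < q; x \<in> A p q\<rbrakk> \<Longrightarrow> f x < of_rat q"
    by metis
  have less: "\<exists>p q. x \<in> A p q \<and> y \<notin> A p q" if "x \<in> topspace X" "f x < f y" for x y
  proof -
    obtain p where p: "f x < of_rat p" "of_rat p < f y"
      using of_rat_dense \<open>f x < f y\<close> by blast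
    obtain q where q: "of_rat p < (of_rat q :: real)" "of_rat q < f y"
      using of_rat_dense p(2) by blast
    have "p < q" using q(1) by (simp add: of_rat_less)
    then show ?thesis using below[of p q x] above[of p q y] that p q by fastforce
  qed
  define B where "B n = (case from_nat n of (p, q) \<Rightarrow> A p q)" for n
  have B: "B (to_nat (p, q)) = A p q" for p q
    by (simp add: B_def)
  show ?thesis
  proof (rule continuous_injection_into_cantor_set)
    show "closedin X (B n)" "openin X (B n)" for n
      using A by (simp_all add: B_def split: prod.split)
    show "\<exists>n. (x \<in> B n) \<noteq> (y \<in> B n)"
      if xy: "x \<in> topspace X" "y \<in> topspace X" "x \<noteq> y" for x y
    proof -
      have "f x < f y \<or> f y < f x"
        using assms(4) xy by (metis inj_onD linorder_neqE)
      then show ?thesis using less xy(1,2) B by metis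
    qed
  qed
qed

end
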